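(* Let $k\ge 2$, let $U$ be a finite nonempty set, let $f:\{0,\ldots,k\}^U\to\mathbb{R}_{+}$ be a $k$-submodular function attaining its maximum value on an orthant $\mathbf{o}\in\{1,\ldots,k\}^U$, and let $\mathbf{x}$ be an orthant selected uniformly at random from $\{1,\ldots,k\}^U$. Then $\mathbb{E}[f(\mathbf{x})]\ge\frac14 f(\mathbf{o})$ if $k=2$, and $\mathbb{E}[f(\mathbf{x})]\ge\frac1k f(\mathbf{o})$ if $k\ge 3$.
   Context: $\mathbb{R}_{+}$ denotes the non-negative reals. For $s,t\in\{0,\ldots,k\}$ define $\mathrm{min}_0(s,t)=0$ if $s\neq 0$, $t\neq 0$ and $s\neq t$, and $\mathrm{min}_0(s,t)=\min(s,t)$ otherwise; define $\mathrm{max}_0(s,t)=0$ if $s\neq 0$, $t\neq 0$ and $s\neq t$, and $\mathrm{max}_0(s,t)=\max(s,t)$ otherwise. Both operations are applied coordinate-wise to vectors. $f$ is $k$-submodular if $f(\mathbf{s})+f(\mathbf{t})\ge f(\mathrm{min}_0(\mathbf{s},\mathbf{t}))+f(\mathrm{max}_0(\mathbf{s},\mathbf{t}))$ for all $\mathbf{s},\mathbf{t}\in\{0,\ldots,k\}^U$. An orthant is a vector in $\{1,\ldots,k\}^U$ (no zero coordinate). *)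

theory Defs
  imports "HOL-Probability.Probability"
begin

definition min0 :: "nat \<Rightarrow> nat \<Rightarrow> nat" where
  "min0 s t = (if s \<noteq> 0 \<and> t \<noteq> 0 \<and> s \<noteq> t then 0 else min s t)"

definition max0 :: "nat \<Rightarrow> nat \<Rightarrow> nat" where
  "max0 s t = (if s \<noteq> 0 \<and> t \<noteq> 0 \<and> s \<noteq> t then 0 else max s t)"

(* Vectors indexed by U are extensional functions (undefined outside U), so that
   there is exactly one function for each vector. *)

definition labelings :: "nat \<Rightarrow> 'a set \<Rightarrow> ('a \<Rightarrow> nat) set" where
  "labelings k U = U \<rightarrow>\<^sub>E {0..k}"

definition orthants :: "nat \<Rightarrow> 'a set \<Rightarrow> ('a \<Rightarrow> nat) set" where
  "orthants k U = U \<rightarrow>\<^sub>E {1..k}"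

definition min0_vec :: "'a set \<Rightarrow> ('a \<Rightarrow> nat) \<Rightarrow> ('a \<Rightarrow> nat) \<Rightarrow> 'a \<Rightarrow> nat" where
  "min0_vec U s t = (\<lambda>u\<in>U. min0 (s u) (t u))"

definition max0_vec :: "'a set \<Rightarrow> ('a \<Rightarrow> nat) \<Rightarrow> ('a \<Rightarrow> nat) \<Rightarrow> 'a \<Rightarrow> nat" where
  "max0_vec U s t = (\<lambda>u\<in>U. max0 (s u) (t u))"

definition k_submodular :: "nat \<Rightarrow> 'a set \<Rightarrow> (('a \<Rightarrow> nat) \<Rightarrow> real) \<Rightarrow> bool" where
  "k_submodular k U f \<longleftrightarrow>
     (\<forall>s\<in>labelings k U. \<forall>t\<in>labelings k U.
        f s + f t \<ge> f (min0_vec U s t) + f (max0_vec U s t))"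

end

theory Submission
  imports Defs
begin

text \<open>Both bounds come from revealing the random orthant one coordinate at a time. For a labelling
  \<open>s\<close> that vanishes on \<open>W\<close>, let \<open>E\<close> be the average of \<open>f\<close> over all ways to fill \<open>W\<close> with nonzero
  labels, and let \<open>s \<squnion> o\<close> denote \<open>s\<close> filled on \<open>W\<close> according to the maximiser \<open>o\<close>. Induction on \<open>W\<close>
  gives \<open>E \<ge> (1/k) f(s \<squnion> o) + (1 - 1/k) f(s)\<close> for \<open>k \<ge> 3\<close>: the \<open>k - 1 \<ge> 2\<close> labels other than that
  of \<open>o\<close> do not decrease \<open>f\<close> on average. For \<open>k = 2\<close> this argument breaks down, and the right
  invariant is \<open>E \<ge> (1/4) f(s \<squnion> o) + (1/4) f(s \<squnion> t) + (1/2) f(s)\<close>, where \<open>t\<close> is the orthant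
  opposite to \<open>o\<close>. The theorem is the case \<open>s = 0\<close>, \<open>W = U\<close>.\<close>

text \<open>Outside \<open>W\<close> a completion copies \<open>s\<close>, including the value
  \<open>undefined\<close> off \<open>U\<close>, so for \<open>W\<close> inside \<open>U\<close>
  completions of an extensional labelling stay extensional. Allowing \<open>s\<close> to be nonzero
  outside \<open>W\<close> makes recursion possible: revealing \<open>u\<close> replaces
  \<open>s\<close> by \<open>s(u := i)\<close>.\<close>

definition completions :: "nat \<Rightarrow> 'a set \<Rightarrow> ('a \<Rightarrow> nat) \<Rightarrow> ('a \<Rightarrow> nat) set" where
  "completions k W s = {x. (\<forall>u\<in>W. x u \<in> {1..k}) \<and> (\<forall>u. u \<notin> W \<longrightarrow> x u = s u)}"

lemma completions_empty [simp]: "completions k {} s = {s}"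
  by (auto simp: completions_def)

lemma completions_insert:
  assumes "u \<notin> W"
  shows "completions k (insert u W) s = (\<Union>i\<in>{1..k}. completions k W (s(u := i)))"
  using assms by (fastforce simp: completions_def)

lemma finite_completions:
  assumes "finite W"
  shows "finite (completions k W s)"
  using assms by (induction W arbitrary: s rule: finite_induct) (auto simp: completions_insert)

text \<open>The union is disjoint because \<open>W\<close> avoids \<open>u\<close>: each completion
  still shows at \<open>u\<close> the label \<open>i\<close> it came from.\<close>

lemma sum_completions_insert:
  assumes "finite W" and "u \<notin> W"
  shows "sum f (completions k (insert u W) s) = (\<Sum>i\<in>{1..k}. sum f (completions k W (s(u := i))))"
  unfolding completions_insert[OF assms(2)]
proof (rule sum.UNION_disjoint)
  show "\<forall>i\<in>{1..k}. \<forall>j\<in>{1..k}. i \<noteq> j \<longrightarrow>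
      completions k W (s(u := i)) \<inter> completions k W (s(u := j)) = {}"
    using assms(2) by (auto simp: completions_def)
qed (use assms in \<open>auto simp: finite_completions\<close>)

lemma completions_zero: "completions k U (\<lambda>u\<in>U. 0) = orthants k U"
  by (auto simp: completions_def orthants_def PiE_iff extensional_def)

lemma labelings_fun_upd:
  "s \<in> labelings k U \<Longrightarrow> u \<in> U \<Longrightarrow> i \<le> k \<Longrightarrow> s(u := i) \<in> labelings k U"
  by (auto simp: labelings_def PiE_iff extensional_def)

lemma labelings_override_on:
  "s \<in> labelings k U \<Longrightarrow> W \<subseteq> U \<Longrightarrow> \<forall>u\<in>W. t u \<le> k \<Longrightarrow> override_on s t W \<in> labelings k U"
  by (auto simp: labelings_def PiE_iff extensional_def override_on_def)

lemma override_on_fun_upd: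
  "u \<notin> W \<Longrightarrow> override_on (s(u := i)) t W = (override_on s t W)(u := i)"
  by (auto simp: override_on_def)

lemma k_submodularD:
  assumes "k_submodular k U f" and "s \<in> labelings k U" and "t \<in> labelings k U"
    and "min0_vec U s t = a" and "max0_vec U s t = b"
  shows "f s + f t \<ge> f a + f b"
  using assms unfolding k_submodular_def by blast

text \<open>The two vectors differ only at \<open>u\<close>, where their labels clash, so
  \<open>min0_vec\<close> and \<open>max0_vec\<close> both return \<open>s\<close>.\<close>

lemma k_submodular_pairwise_monotone:
  assumes "k_submodular k U f" and s: "s \<in> labelings k U" and u: "u \<in> U" "s u = 0"
    and "i \<in> {1..k}" "j \<in> {1..k}" "i \<noteq> j"
  shows "f (s(u := i)) + f (s(u := j)) \<ge> 2 * f s"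
proof -
  have "f (s(u := i)) + f (s(u := j)) \<ge> f s + f s"
    by (rule k_submodularD[OF assms(1)])
      (use assms in \<open>auto simp: labelings_fun_upd min0_vec_def max0_vec_def min0_def max0_def
        fun_eq_iff labelings_def PiE_iff extensional_def\<close>)
  then show ?thesis by simp
qed

text \<open>Diminishing returns: label \<open>i\<close> at \<open>u\<close> gains at least as much
  over \<open>s\<close> as over \<open>s\<close> already filled on \<open>W\<close>. Here
  \<open>min0_vec\<close> gives \<open>s\<close>, and \<open>max0_vec\<close> merges the two
  additions.\<close>

lemma k_submodular_same_label:
  assumes "k_submodular k U f" and "s \<in> labelings k U" and "u \<in> U" "W \<subseteq> U" "u \<notin> W"
    and "s u = 0" "\<forall>v\<in>W. s v = 0" "\<forall>v\<in>W. t v \<le> k" and "i \<in> {1..k}"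
  shows "f (override_on s t W) + f (s(u := i)) \<ge> f s + f ((override_on s t W)(u := i))"
  by (rule k_submodularD[OF assms(1)])
    (use assms in \<open>auto simp: labelings_fun_upd labelings_override_on min0_vec_def max0_vec_def
      min0_def max0_def fun_eq_iff labelings_def PiE_iff extensional_def override_on_def\<close>)

text \<open>The clash of \<open>i\<close> and \<open>j\<close> resets \<open>u\<close> to 0, while
  \<open>max0_vec\<close> keeps \<open>t\<close> on \<open>W\<close>. Thus any loss from putting
  \<open>i\<close> on the filled labelling is paid for by the gain of \<open>j\<close> over
  \<open>s\<close>.\<close>

lemma k_submodular_opposite_label:
  assumes "k_submodular k U f" and "s \<in> labelings k U" and "u \<in> U" "W \<subseteq> U" "u \<notin> W"
    and "s u = 0" "\<forall>v\<in>W. s v = 0" "\<forall>v\<in>W. t v \<le> k" and "i \<in> {1..k}" "j \<in> {1..k}" "i \<noteq> j"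
  shows "f ((override_on s t W)(u := i)) + f (s(u := j)) \<ge> f s + f (override_on s t W)"
  by (rule k_submodularD[OF assms(1)])
    (use assms in \<open>auto simp: labelings_fun_upd labelings_override_on min0_vec_def max0_vec_def
      min0_def max0_def fun_eq_iff labelings_def PiE_iff extensional_def override_on_def\<close>)

text \<open>At most one value can lie below \<open>c\<close>, and pairing it with any other element
  of \<open>L\<close> makes up its deficit.\<close>

lemma sum_ge_card_mult_of_pairs:
  fixes a :: "'b \<Rightarrow> real"
  assumes "finite L" and "card L \<ge> 2"
    and pair: "\<And>i j. i \<in> L \<Longrightarrow> j \<in> L \<Longrightarrow> i \<noteq> j \<Longrightarrow> a i + a j \<ge> 2 * c"
  shows "sum a L \<ge> real (card L) * c"
proof (cases "\<exists>m\<in>L. a m < c")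
  case False
  then show ?thesis using sum_bounded_below[of L c a] by (auto simp: not_less)
next
  case True
  then obtain m where m: "m \<in> L" "a m < c" by blast
  have "L \<noteq> {m}" using assms(2) by auto
  then obtain j where j: "j \<in> L" "j \<noteq> m" using m by blast
  have rest: "real (card (L - {m} - {j})) * c \<le> sum a (L - {m} - {j})"
    by (rule sum_bounded_below) (use pair m in fastforce)
  have "sum a L = a m + (a j + sum a (L - {m} - {j}))"
    using assms(1) m j by (simp add: sum.remove)
  moreover have "card L = Suc (Suc (card (L - {m} - {j})))"
    using assms(1) m j by (metis card.remove finite_Diff insertE insert_Diff)
  ultimately show ?thesis
    using rest pair[OF m(1) j(1)] j(2) by (simp add: algebra_simps)
qed

text \<open>The invariant for k \<ge> 3 with denominators cleared: the average over the completions
  is multiplied by \<open>k * k ^ card W\<close>.\<close>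

lemma sum_completions_ge:
  assumes "k \<ge> 3" and f: "k_submodular k U f" and "finite W" "W \<subseteq> U"
    and t: "\<forall>u\<in>W. t u \<in> {1..k}" and "s \<in> labelings k U" "\<forall>u\<in>W. s u = 0"
  shows "real k * sum f (completions k W s)
    \<ge> real k ^ card W * (f (override_on s t W) + (real k - 1) * f s)"
  using assms(3-)
proof (induction W arbitrary: s rule: finite_induct)
  case empty
  then show ?case by (simp add: algebra_simps)
next
  case (insert u V)
  let ?r = "override_on s t V"
  let ?L = "{1..k} - {t u}"
  have r: "?r \<in> labelings k U" "?r u = 0"
    using insert by (auto intro!: labelings_override_on)
  have split: "(\<Sum>i\<in>{1..k}. h i) = h (t u) + sum h ?L" for h :: "nat \<Rightarrow> real"
    using insert.prems by (simp add: sum.remove)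
  have card: "card ?L = k - 1" using insert.prems by simp
  \<comment> \<open>The pairing requires two labels other than \<open>t u\<close>, hence k \<ge> 3.
    The bound serves for both \<open>s\<close> and \<open>?r\<close>.\<close>
  have mono: "(\<Sum>i\<in>?L. f (q(u := i))) \<ge> (real k - 1) * f q"
    if "q \<in> labelings k U" "q u = 0" for q
  proof -
    have "(\<Sum>i\<in>?L. f (q(u := i))) \<ge> real (card ?L) * f q"
      by (rule sum_ge_card_mult_of_pairs)
        (use card assms(1) insert.prems that in \<open>auto intro!: k_submodular_pairwise_monotone[OF f]\<close>)
    then show ?thesis using card assms(1) by (simp add: of_nat_diff)
  qed
  have sub: "f ?r + f (s(u := t u)) \<ge> f s + f (?r(u := t u))"
    by (rule k_submodular_same_label[OF f]) (use insert in auto)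
  have IH: "real k * sum f (completions k V (s(u := i)))
      \<ge> real k ^ card V * (f (?r(u := i)) + (real k - 1) * f (s(u := i)))" if "i \<in> {1..k}" for i
  proof -
    have "s(u := i) \<in> labelings k U" "\<forall>v\<in>V. (s(u := i)) v = 0"
      using that insert.prems insert.hyps by (auto intro: labelings_fun_upd)
    moreover have "V \<subseteq> U" "\<forall>v\<in>V. t v \<in> {1..k}"
      using insert.prems by blast+
    ultimately show ?thesis
      using insert.IH by (simp only: override_on_fun_upd[OF insert.hyps(2), symmetric])
  qed
  have "real k * sum f (completions k (insert u V) s)
      = (\<Sum>i\<in>{1..k}. real k * sum f (completions k V (s(u := i))))"
    using insert.hyps by (simp add: sum_completions_insert sum_distrib_left)
  also have "\<dots> \<ge> (\<Sum>i\<in>{1..k}. real k ^ card V * (f (?r(u := i)) + (real k - 1) * f (s(u := i))))"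
    by (rule sum_mono) (rule IH)
  also have "(\<Sum>i\<in>{1..k}. real k ^ card V * (f (?r(u := i)) + (real k - 1) * f (s(u := i))))
      = real k ^ card V * ((\<Sum>i\<in>{1..k}. f (?r(u := i))) + (real k - 1) * (\<Sum>i\<in>{1..k}. f (s(u := i))))"
    by (simp only: sum_distrib_left[symmetric] sum.distrib)
  finally have "real k * sum f (completions k (insert u V) s) \<ge> real k ^ card V *
      ((\<Sum>i\<in>{1..k}. f (?r(u := i))) + (real k - 1) * (\<Sum>i\<in>{1..k}. f (s(u := i))))" .
  \<comment> \<open>Apply \<open>mono\<close> once to \<open>?r\<close> and with weight
    \<open>k - 1\<close> to \<open>s\<close>. Then \<open>sub\<close>, also with weight
    \<open>k - 1\<close>, exchanges \<open>f ?r\<close> for \<open>f (?r(u := t u))\<close>.\<close>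
  moreover have "(\<Sum>i\<in>{1..k}. f (?r(u := i))) + (real k - 1) * (\<Sum>i\<in>{1..k}. f (s(u := i)))
      \<ge> real k * (f (?r(u := t u)) + (real k - 1) * f s)"
  proof -
    have "(real k - 1) * (\<Sum>i\<in>?L. f (s(u := i))) \<ge> (real k - 1) * ((real k - 1) * f s)"
      by (rule mult_left_mono) (use mono[of s] insert.prems assms(1) in auto)
    moreover have "(real k - 1) * (f ?r + f (s(u := t u))) \<ge> (real k - 1) * (f s + f (?r(u := t u)))"
      by (rule mult_left_mono) (use sub assms(1) in auto)
    ultimately show ?thesis
      using mono[OF r] unfolding split by (simp add: algebra_simps)
  qed
  then have "real k ^ card V * ((\<Sum>i\<in>{1..k}. f (?r(u := i))) + (real k - 1) * (\<Sum>i\<in>{1..k}. f (s(u := i))))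
      \<ge> real k ^ card V * (real k * (f (?r(u := t u)) + (real k - 1) * f s))"
    by (rule mult_left_mono) simp
  ultimately show ?case
    unfolding override_on_insert card_insert_disjoint[OF insert.hyps] power_Suc by (simp only: mult_ac)
qed

text \<open>With two labels only one differs from that of \<open>p\<close>, so it has no partner to
  be paired with. Carrying the opposite filling \<open>q\<close> along gives both labels symmetric
  roles.\<close>

lemma sum_completions_two_ge:
  assumes f: "k_submodular 2 U f" and "finite W" "W \<subseteq> U"
    and "\<forall>u\<in>W. {1..2} = {p u, q u} \<and> p u \<noteq> q u" and "s \<in> labelings 2 U" "\<forall>u\<in>W. s u = 0"
  shows "4 * sum f (completions 2 W s)
    \<ge> 2 ^ card W * (f (override_on s p W) + f (override_on s q W) + 2 * f s)"
  using assms(2-)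
proof (induction W arbitrary: s rule: finite_induct)
  case empty
  then show ?case by simp
next
  case (insert u V)
  let ?P = "override_on s p V" and ?Q = "override_on s q V"
  have pq: "p v \<in> {1..2}" "q v \<in> {1..2}" "p v \<noteq> q v" "{1..2} = {p v, q v}" if "v \<in> insert u V" for v
    using insert.prems(2) that by blast+
  have le: "\<forall>v\<in>V. p v \<le> 2" "\<forall>v\<in>V. q v \<le> 2"
    using pq by (meson atLeastAtMost_iff insertI2)+
  have IH: "4 * sum f (completions 2 V (s(u := i)))
      \<ge> 2 ^ card V * (f (?P(u := i)) + f (?Q(u := i)) + 2 * f (s(u := i)))" if "i \<in> {1..2}" for i
  proof -
    have "s(u := i) \<in> labelings 2 U" "\<forall>v\<in>V. (s(u := i)) v = 0"
      using that insert.prems insert.hyps by (auto intro: labelings_fun_upd)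
    moreover have "V \<subseteq> U" "\<forall>v\<in>V. {1..2} = {p v, q v} \<and> p v \<noteq> q v"
      using insert.prems by blast+
    ultimately show ?thesis
      using insert.IH by (simp only: override_on_fun_upd[OF insert.hyps(2), symmetric])
  qed
  \<comment> \<open>Adding \<open>P\<close> and \<open>P'\<close> cancels \<open>f ?P\<close> and
    bounds the mixed term \<open>f (?P(u := q u))\<close> below by
    \<open>f (?P(u := p u)) + 2 * f s - 2 * f (s(u := p u))\<close>; likewise for \<open>?Q\<close>.
    The induction hypothesis supplies exactly the subtracted terms.\<close>
  have P: "f ?P + f (s(u := p u)) \<ge> f s + f (?P(u := p u))"
    and P': "f (?P(u := q u)) + f (s(u := p u)) \<ge> f s + f ?P"
    and Q: "f ?Q + f (s(u := q u)) \<ge> f s + f (?Q(u := q u))"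
    and Q': "f (?Q(u := p u)) + f (s(u := q u)) \<ge> f s + f ?Q"
    using insert.prems insert.hyps pq[of u] le
    by (intro k_submodular_same_label[OF f] k_submodular_opposite_label[OF f]; auto)+
  have "sum f (completions 2 (insert u V) s)
      = sum f (completions 2 V (s(u := p u))) + sum f (completions 2 V (s(u := q u)))"
    using insert.hyps pq[of u] by (simp add: sum_completions_insert)
  then have "4 * sum f (completions 2 (insert u V) s)
      \<ge> 2 ^ card V * (f (?P(u := p u)) + f (?Q(u := p u)) + 2 * f (s(u := p u))
        + (f (?P(u := q u)) + f (?Q(u := q u)) + 2 * f (s(u := q u))))"
    using IH[OF pq(1)[of u]] IH[OF pq(2)[of u]] by (simp add: distrib_left)
  moreover have "2 ^ card V * (f (?P(u := p u)) + f (?Q(u := p u)) + 2 * f (s(u := p u))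
        + (f (?P(u := q u)) + f (?Q(u := q u)) + 2 * f (s(u := q u))))
      \<ge> 2 ^ card V * (2 * (f (?P(u := p u)) + f (?Q(u := q u)) + 2 * f s))"
    using P P' Q Q' by (intro mult_left_mono) simp_all
  ultimately show ?case
    unfolding override_on_insert card_insert_disjoint[OF insert.hyps] power_Suc by (simp only: mult_ac)
qed

lemma card_orthants: "finite U \<Longrightarrow> card (orthants k U) = k ^ card U"
  by (simp add: orthants_def card_PiE)

lemma expectation_orthants:
  fixes f :: "('a \<Rightarrow> nat) \<Rightarrow> real"
  assumes "k \<ge> 1" "finite U"
  shows "measure_pmf.expectation (pmf_of_set (orthants k U)) f = sum f (orthants k U) / real k ^ card U"
proof -
  have "orthants k U \<noteq> {}" using assms by (auto simp: orthants_def PiE_eq_empty_iff)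
  moreover have "finite (orthants k U)" using assms by (simp add: orthants_def finite_PiE)
  ultimately show ?thesis using assms by (simp add: integral_pmf_of_set card_orthants)
qed

theorem theorem10:
  fixes k :: nat and U :: "'a set" and f :: "('a \<Rightarrow> nat) \<Rightarrow> real" and orth :: "'a \<Rightarrow> nat"
  assumes "k \<ge> 2"
    and "finite U" and "U \<noteq> {}"
    and "\<forall>s\<in>labelings k U. f s \<ge> 0"
    and "k_submodular k U f"
    and "orth \<in> orthants k U"
    and "\<forall>s\<in>labelings k U. f s \<le> f orth"
  shows "(k = 2 \<longrightarrow> measure_pmf.expectation (pmf_of_set (orthants k U)) f \<ge> 1 / 4 * f orth) \<and>
         (k \<ge> 3 \<longrightarrow> measure_pmf.expectation (pmf_of_set (orthants k U)) f \<ge> 1 / real k * f orth)"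
proof -
  let ?z = "\<lambda>u\<in>U. 0::nat"
  let ?E = "measure_pmf.expectation (pmf_of_set (orthants k U)) f"
  have z: "?z \<in> labelings k U" by (simp add: labelings_def)
  have orth: "orth u \<in> {1..k}" if "u \<in> U" for u
    using assms(6) that by (auto simp: orthants_def PiE_iff)
  have filled: "override_on ?z orth U = orth"
    using assms(6) by (auto simp: override_on_def fun_eq_iff orthants_def PiE_iff extensional_def)
  have E: "?E * real k ^ card U = sum f (completions k U ?z)"
    using assms(1,2) by (simp add: expectation_orthants completions_zero)
  show ?thesis
  proof (intro conjI impI)
    assume k: "k = 2"
    \<comment> \<open>On \<open>U\<close> this swaps the labels 1 and 2.\<close>
    let ?t = "\<lambda>u. 3 - orth u"
    have t: "\<forall>u\<in>U. {1..2} = {orth u, ?t u} \<and> orth u \<noteq> ?t u"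
    proof
      fix u assume "u \<in> U"
      then have "orth u = 1 \<or> orth u = 2" using orth[of u] k by auto
      then show "{1..2} = {orth u, ?t u} \<and> orth u \<noteq> ?t u" by auto
    qed
    have "override_on ?z ?t U \<in> labelings k U"
      using t z k by (auto intro!: labelings_override_on simp: set_eq_iff)
    \<comment> \<open>Nonnegativity discards the opposite orthant and the zero labelling, leaving
      one quarter of \<open>f orth\<close>.\<close>
    then have "f (override_on ?z ?t U) \<ge> 0" "f ?z \<ge> 0" using assms(4) z by auto
    then have "2 ^ card U * (f orth + f (override_on ?z ?t U) + 2 * f ?z) \<ge> 2 ^ card U * f orth"
      by simp
    also have "2 ^ card U * (f orth + f (override_on ?z ?t U) + 2 * f ?z)
        \<le> 4 * sum f (completions 2 U ?z)"
      using sum_completions_two_ge[of U f U orth ?t ?z] assms(2,5) t z k filled by simp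
    finally have "2 ^ card U * f orth \<le> 2 ^ card U * (4 * ?E)" using E k by (simp add: mult_ac)
    then show "?E \<ge> 1 / 4 * f orth" by simp
  next
    assume k: "k \<ge> 3"
    have "(real k - 1) * f ?z \<ge> 0" using assms(4) z k by simp
    then have "real k ^ card U * (f orth + (real k - 1) * f ?z) \<ge> real k ^ card U * f orth"
      by (intro mult_left_mono) auto
    also have "real k ^ card U * (f orth + (real k - 1) * f ?z) \<le> real k * sum f (completions k U ?z)"
      using sum_completions_ge[of k U f U orth ?z] assms(2,5) orth z k filled by simp
    finally have "real k ^ card U * f orth \<le> real k ^ card U * (real k * ?E)"
      using E by (simp add: mult_ac)
    then have "f orth \<le> real k * ?E" using k by simp
    then show "?E \<ge> 1 / real k * f orth" using k by (simp add: field_simps)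
  qed
qed

end
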